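(* Let $J:\mathbb{R}^n\to\mathbb{R}$ be a continuous convex function, $A\in\mathbb{R}^{m\times n}$, $b\in\mathbb{R}^m$, $\mu>0$, and let $(x^*,y^* )$ be a pair of optimal primal and dual solutions of $$\min_{x\in\mathbb{R}^n}\;J(x)+\tfrac1{2\mu}\|x\|^2\quad\text{subject to}\quad Ax=b. \qquad(\mathrm P)$$ Let $\mathcal L_\mu(x,y)=J(x)+\frac1{2\mu}\|x\|^2-\langle y,Ax-b\rangle$ and $G_\mu(y)=-\min_{w\in\mathbb{R}^n}\mathcal L_\mu(w,y)$, let $L>0$ be the Lipschitz constant of $\nabla G_\mu$, and let $0<\tau\le\frac1L$. Let $\{x^k\}$ be generated by the linearized Bregman method: $x^0=p^0=0$ and for $k=0,1,\dots$ $$x^{k+1}=\arg\min_{x}\; D_J^{p^k}(x,x^k)+\tau\langle A^\top(Ax^k-b),x\rangle+\tfrac1{2\mu}\|x-x^k\|^2,\qquad p^{k+1}=p^k-\tau A^\top(Ax^k-b)-\tfrac1\mu(x^{k+1}-x^k),$$ and let $\{y^k\}$ be generated by: $y^0=\tau b$ and for $k=0,1,\dots$ $$w^{k+1}=\arg\min_{w}\;\mathcal L_\mu(w,y^k),\qquad y^{k+1}=y^k-\tau(Aw^{k+1}-b).$$ Then for all $k\ge1$, $$\mathcal L_\mu(x^*,y^* )-\mathcal L_\mu(x^{k+1},y^k)\le\frac{\|y^*-y^0\|^2}{2\tau k}.$$ Thus, if furthermore $\tau\ge\beta/L$ with $0<\beta\le1$, then for every $\epsilon>0$ the pair $(x^{k+1},y^k)$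 is an $\epsilon$-optimal solution of (P) with respect to the Lagrangian function, i.e. $\mathcal L_\mu(x^*,y^* )-\mathcal L_\mu(x^{k+1},y^k)\le\epsilon$, whenever $k\ge\lceil C/\epsilon\rceil$, where $C:=\frac{L\|y^*-y^0\|^2}{2\beta}$.
   Context: $\|\cdot\|$ is the Euclidean norm and $\langle\cdot,\cdot\rangle$ the standard inner product. For vectors $u,v,p\in\mathbb{R}^n$, $D_J^p(u,v):=J(u)-J(v)-\langle p,u-v\rangle$. A pair of optimal primal and dual solutions means: $x^*$ solves (P), and $y^*$ is a minimizer of $G_\mu$ over $\mathbb{R}^m$ (the Lagrangian dual of (P), written as a minimization problem), with $\mathcal L_\mu(x^*,y^* )=-G_\mu(y^* )$. The function $G_\mu$ is differentiable with $\nabla G_\mu(y)=Aw_y-b$, where $w_y=\arg\min_w\mathcal L_\mu(w,y)$; $L$ being the Lipschitz constant of $\nabla G_\mu$ means $\|\nabla G_\mu(y)-\nabla G_\mu(y')\|\le L\|y-y'\|$ for all $y,y'\in\mathbb{R}^m$. All minimizers in the algorithms are unique by strong convexity. *)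

theory Defs
  imports "HOL-Analysis.Analysis"
begin

definition gradient :: "('a::euclidean_space \<Rightarrow> real) \<Rightarrow> 'a \<Rightarrow> 'a" where
  "gradient f x = (THE D. GDERIV f x :> D)"

lemma gradient_eqI: "GDERIV f x :> D \<Longrightarrow> gradient f x = D"
  unfolding gradient_def
proof (rule the_equality)
  fix D' assume D: "GDERIV f x :> D" and D': "GDERIV f x :> D'"
  have "(\<lambda>h. h \<bullet> D') = (\<lambda>h. h \<bullet> D)"
    using D D' unfolding gderiv_def by (rule has_derivative_unique[rotated])
  then show "D' = D"
    by (metis inner_commute vector_eq_rdot)
qed

text \<open>\<open>D\<^sub>J\<^sup>p(u, v)\<close>, for an arbitrary vector \<open>p\<close>.\<close>

definition bregman :: "(real ^ 'n \<Rightarrow> real) \<Rightarrow> real ^ 'n \<Rightarrow> real ^ 'n \<Rightarrow> real ^ 'n \<Rightarrow> real" where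
  "bregman J p u v = J u - J v - p \<bullet> (u - v)"

definition primal_obj :: "(real ^ 'n \<Rightarrow> real) \<Rightarrow> real \<Rightarrow> real ^ 'n \<Rightarrow> real" where
  "primal_obj J \<mu> x = J x + 1 / (2 * \<mu>) * (norm x)\<^sup>2"

definition lagrangian ::
  "(real ^ 'n \<Rightarrow> real) \<Rightarrow> real ^ 'n ^ 'm \<Rightarrow> real ^ 'm \<Rightarrow> real \<Rightarrow> real ^ 'n \<Rightarrow> real ^ 'm \<Rightarrow> real" where
  "lagrangian J A b \<mu> x y = J x + 1 / (2 * \<mu>) * (norm x)\<^sup>2 - y \<bullet> (A *v x - b)"

text \<open>The minimum over \<open>w\<close> is written as an infimum; the two agree whenever a minimizer exists
  (lemma \<open>dual_obj_eq\<close>), which is always the case for convex \<open>J\<close> and \<open>\<mu> > 0\<close>.\<close>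

definition dual_obj ::
  "(real ^ 'n \<Rightarrow> real) \<Rightarrow> real ^ 'n ^ 'm \<Rightarrow> real ^ 'm \<Rightarrow> real \<Rightarrow> real ^ 'm \<Rightarrow> real" where
  "dual_obj J A b \<mu> y = - (INF w. lagrangian J A b \<mu> w y)"

abbreviation is_minimizer :: "('a \<Rightarrow> real) \<Rightarrow> 'a \<Rightarrow> bool" where
  "is_minimizer f \<equiv> is_arg_min f (\<lambda>_. True)"

lemma dual_obj_eq:
  assumes "is_minimizer (\<lambda>w. lagrangian J A b \<mu> w y) w"
  shows "dual_obj J A b \<mu> y = - lagrangian J A b \<mu> w y"
  using assms unfolding dual_obj_def is_arg_min_linorder
  by (auto intro!: cInf_eq_minimum)

definition optimal_pair ::
  "(real ^ 'n \<Rightarrow> real) \<Rightarrow> real ^ 'n ^ 'm \<Rightarrow> real ^ 'm \<Rightarrow> real \<Rightarrow> real ^ 'n \<Rightarrow> real ^ 'm \<Rightarrow> bool" where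
  "optimal_pair J A b \<mu> xs ys \<longleftrightarrow>
     is_arg_min (primal_obj J \<mu>) (\<lambda>x. A *v x = b) xs \<and>
     is_minimizer (dual_obj J A b \<mu>) ys \<and>
     lagrangian J A b \<mu> xs ys = - dual_obj J A b \<mu> ys"

definition linearized_bregman ::
  "(real ^ 'n \<Rightarrow> real) \<Rightarrow> real ^ 'n ^ 'm \<Rightarrow> real ^ 'm \<Rightarrow> real \<Rightarrow> real \<Rightarrow>
   (nat \<Rightarrow> real ^ 'n) \<Rightarrow> (nat \<Rightarrow> real ^ 'n) \<Rightarrow> bool" where
  "linearized_bregman J A b \<mu> \<tau> x p \<longleftrightarrow>
     x 0 = 0 \<and> p 0 = 0 \<and>
     (\<forall>k. is_minimizer
            (\<lambda>u. bregman J (p k) u (x k) + \<tau> * ((transpose A *v (A *v x k - b)) \<bullet> u)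
                 + 1 / (2 * \<mu>) * (norm (u - x k))\<^sup>2)
            (x (Suc k)) \<and>
          p (Suc k) = p k - \<tau> *\<^sub>R (transpose A *v (A *v x k - b))
                      - (1 / \<mu>) *\<^sub>R (x (Suc k) - x k))"

text \<open>The iterates \<open>w\<close> start at index 1; \<open>w 0\<close> is unconstrained.\<close>

definition lagrangian_gradient_method ::
  "(real ^ 'n \<Rightarrow> real) \<Rightarrow> real ^ 'n ^ 'm \<Rightarrow> real ^ 'm \<Rightarrow> real \<Rightarrow> real \<Rightarrow>
   (nat \<Rightarrow> real ^ 'n) \<Rightarrow> (nat \<Rightarrow> real ^ 'm) \<Rightarrow> bool" where
  "lagrangian_gradient_method J A b \<mu> \<tau> w y \<longleftrightarrow>
     y 0 = \<tau> *\<^sub>R b \<and>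
     (\<forall>k. is_minimizer (\<lambda>u. lagrangian J A b \<mu> u (y k)) (w (Suc k)) \<and>
          y (Suc k) = y k - \<tau> *\<^sub>R (A *v w (Suc k) - b))"

definition lagrangian_eps_optimal ::
  "(real ^ 'n \<Rightarrow> real) \<Rightarrow> real ^ 'n ^ 'm \<Rightarrow> real ^ 'm \<Rightarrow> real \<Rightarrow> real ^ 'n \<Rightarrow> real ^ 'm \<Rightarrow>
   real \<Rightarrow> real ^ 'n \<Rightarrow> real ^ 'm \<Rightarrow> bool" where
  "lagrangian_eps_optimal J A b \<mu> xs ys \<epsilon> x y \<longleftrightarrow>
     lagrangian J A b \<mu> xs ys - lagrangian J A b \<mu> x y \<le> \<epsilon>"

end

theory Submission
  imports Defs
begin

text \<open>
  The linearized Bregman method is gradient descent with step \<open>\<tau>\<close> on the dual objective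
  \<open>G = dual_obj J A b \<mu>\<close>, seen through its primal minimizers.

  Put \<open>q\<^sub>k = p\<^sub>k + x\<^sub>k / \<mu>\<close>. The update of \<open>p\<close> says
  \<open>q\<^sub>k\<^sub>+\<^sub>1 = q\<^sub>k - \<tau> A\<^sup>T (A x\<^sub>k - b)\<close>, and after expanding the two quadratic terms the update of \<open>x\<close> says
  that \<open>x\<^sub>k\<^sub>+\<^sub>1\<close> minimizes \<open>J u + \<parallel>u\<parallel>\<^sup>2 / (2 \<mu>) - q\<^sub>k\<^sub>+\<^sub>1 \<bullet> u\<close>. Up to a constant this is the Lagrangian
  at any \<open>y\<close> with \<open>A\<^sup>T y = q\<^sub>k\<^sub>+\<^sub>1\<close>, and by induction \<open>y\<^sub>k\<close> is such a \<open>y\<close>; the start \<open>y\<^sub>0 = \<tau> b\<close> matches the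
  first step from \<open>x\<^sub>0 = p\<^sub>0 = 0\<close>. Hence \<open>x\<^sub>k\<^sub>+\<^sub>1\<close> minimizes the Lagrangian at \<open>y\<^sub>k\<close>
  (\<open>linearized_bregman_minimizes_lagrangian\<close>), and the gap in the theorem is \<open>G y\<^sub>k - G y\<^sup>*\<close>.

  That \<open>y\<^sub>k\<close> is produced by gradient descent needs \<open>\<nabla>G y = A w\<^sub>y - b\<close>, where \<open>w\<^sub>y\<close> minimizes the
  Lagrangian at \<open>y\<close> (\<open>gderiv_dual_obj\<close>). Comparing values at \<open>w\<^sub>y\<close> makes \<open>A w\<^sub>y - b\<close> a subgradient of \<open>G\<close>.
  The Lagrangian is strongly convex in \<open>w\<close>, hence grows quadratically away from its minimizer, and
  this bounds the error of the linearization of \<open>G\<close> by a multiple of \<open>\<parallel>y' - y\<parallel>\<^sup>2\<close>. With continuity of \<open>J\<close>, the same growth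
  gives minimizers for every \<open>y\<close> once there is one for some \<open>y\<close>, and it makes
  minimizers unique.

  What remains is the classical \<open>O(1/k)\<close> rate of gradient descent for a convex function with
  \<open>L\<close>-Lipschitz gradient and step at most \<open>1/L\<close> (\<open>gradient_descent_rate\<close>).
\<close>

section \<open>Gradient descent for smooth convex functions\<close>

text \<open>Along a segment the derivative of \<open>f\<close> exceeds its initial value by at most
  \<open>t L \<parallel>d\<parallel>\<^sup>2\<close>; integrating over \<open>t \<in> [0,1]\<close> produces the factor \<open>1/2\<close>.\<close>

lemma lipschitz_gradient_upper_bound:
  fixes f :: "'a::euclidean_space \<Rightarrow> real"
  assumes grad: "\<And>z. GDERIV f z :> g z" and lip: "L-lipschitz_on UNIV g"
  shows "f (z + d) \<le> f z + d \<bullet> g z + L / 2 * (norm d)\<^sup>2"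
proof -
  define \<psi> where "\<psi> t = f (z + t *\<^sub>R d) - t * (d \<bullet> g z) - t\<^sup>2 * (L / 2 * (norm d)\<^sup>2)" for t
  have deriv: "(\<psi> has_real_derivative
      (d \<bullet> g (z + t *\<^sub>R d) - d \<bullet> g z - t * (L * (norm d)\<^sup>2))) (at t)" for t
  proof -
    have "((\<lambda>t. z + t *\<^sub>R d) has_derivative (\<lambda>h. h *\<^sub>R d)) (at t)"
      by (auto intro!: derivative_eq_intros)
    moreover have "(f has_derivative (\<lambda>h. h \<bullet> g (z + t *\<^sub>R d))) (at (z + t *\<^sub>R d))"
      using grad unfolding gderiv_def .
    ultimately have "((\<lambda>t. f (z + t *\<^sub>R d)) has_derivative (\<lambda>h. (h *\<^sub>R d) \<bullet> g (z + t *\<^sub>R d))) (at t)"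
      by (rule has_derivative_compose)
    then have "((\<lambda>t. f (z + t *\<^sub>R d)) has_real_derivative (d \<bullet> g (z + t *\<^sub>R d))) (at t)"
      by (simp add: has_field_derivative_def mult.commute[of _ "d \<bullet> _"])
    then show ?thesis unfolding \<psi>_def
      by (auto intro!: derivative_eq_intros)
  qed
  have "\<psi> 1 \<le> \<psi> 0"
  proof (rule DERIV_nonpos_imp_nonincreasing[of 0 1 \<psi>])
    fix t :: real assume t: "0 \<le> t" "t \<le> 1"
    have "d \<bullet> (g (z + t *\<^sub>R d) - g z) \<le> norm d * norm (g (z + t *\<^sub>R d) - g z)"
      by (rule norm_cauchy_schwarz)
    also have "\<dots> \<le> norm d * (L * norm (t *\<^sub>R d))"
      using lipschitz_onD[OF lip, of "z + t *\<^sub>R d" z]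
      by (intro mult_left_mono) (auto simp: dist_norm)
    also have "\<dots> = t * (L * (norm d)\<^sup>2)" using t by (simp add: power2_eq_square)
    finally have "d \<bullet> g (z + t *\<^sub>R d) - d \<bullet> g z - t * (L * (norm d)\<^sup>2) \<le> 0"
      by (simp add: inner_diff_right)
    with deriv show "\<exists>y. (\<psi> has_real_derivative y) (at t) \<and> y \<le> 0" by blast
  qed simp
  then show ?thesis by (simp add: \<psi>_def)
qed

text \<open>A step decreases \<open>f\<close> by at least \<open>\<tau>/2 \<parallel>g\<parallel>\<^sup>2\<close>, because \<open>L \<tau> \<le> 1\<close>. Together with the subgradient
  inequality towards \<open>z\<close> this completes the square in
  \<open>\<parallel>y\<^sub>j - z\<parallel>\<^sup>2 - \<parallel>y\<^sub>j\<^sub>+\<^sub>1 - z\<parallel>\<^sup>2\<close>, so the gaps telescope, and by monotonicity the last gap is at most their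
  average.\<close>

lemma gradient_descent_rate:
  fixes f :: "'a::euclidean_space \<Rightarrow> real"
  assumes grad: "\<And>z. GDERIV f z :> g z" and lip: "L-lipschitz_on UNIV g"
    and subgrad: "\<And>u v. f v \<ge> f u + (v - u) \<bullet> g u"
    and "0 < \<tau>" and L\<tau>: "L * \<tau> \<le> 1"
    and step: "\<And>j. y (Suc j) = y j - \<tau> *\<^sub>R g (y j)"
  shows "2 * \<tau> * real k * (f (y k) - f z) \<le> (norm (z - y 0))\<^sup>2"
proof -
  have descent: "f (y (Suc j)) \<le> f (y j) - \<tau> / 2 * (norm (g (y j)))\<^sup>2" for j
  proof -
    have "f (y (Suc j)) \<le> f (y j) - \<tau> * (norm (g (y j)))\<^sup>2 + L / 2 * (\<tau> * norm (g (y j)))\<^sup>2"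
      using lipschitz_gradient_upper_bound[OF grad lip, of "y j" "- \<tau> *\<^sub>R g (y j)"] \<open>0 < \<tau>\<close>
      by (simp add: step power2_norm_eq_inner)
    also have "L / 2 * (\<tau> * norm (g (y j)))\<^sup>2 = (L * \<tau>) * (\<tau> / 2 * (norm (g (y j)))\<^sup>2)"
      by (simp add: power2_eq_square)
    also have "\<dots> \<le> 1 * (\<tau> / 2 * (norm (g (y j)))\<^sup>2)"
      using L\<tau> \<open>0 < \<tau>\<close> by (intro mult_right_mono) auto
    finally show ?thesis by (simp add: algebra_simps)
  qed
  have gap: "2 * \<tau> * (f (y (Suc j)) - f z) \<le> (norm (z - y j))\<^sup>2 - (norm (z - y (Suc j)))\<^sup>2" for j
  proof -
    have "f (y (Suc j)) - f z \<le> - ((z - y j) \<bullet> g (y j)) - \<tau> / 2 * (norm (g (y j)))\<^sup>2"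
      using descent[of j] subgrad[of "y j" z] by linarith
    then have "2 * \<tau> * (f (y (Suc j)) - f z)
        \<le> 2 * \<tau> * (- ((z - y j) \<bullet> g (y j)) - \<tau> / 2 * (norm (g (y j)))\<^sup>2)"
      using \<open>0 < \<tau>\<close> by (intro mult_left_mono) auto
    also have "\<dots> = (norm (z - y j))\<^sup>2 - (norm ((z - y j) + \<tau> *\<^sub>R g (y j)))\<^sup>2"
      unfolding power2_norm_eq_inner
      by (simp add: inner_add_left inner_add_right inner_commute algebra_simps)
    also have "(z - y j) + \<tau> *\<^sub>R g (y j) = z - y (Suc j)"
      by (simp add: step)
    finally show ?thesis .
  qed
  have "2 * \<tau> * real k * (f (y k) - f z) + (norm (z - y k))\<^sup>2 \<le> (norm (z - y 0))\<^sup>2"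
  proof (induction k)
    case (Suc k)
    have "f (y (Suc k)) \<le> f (y k)"
      using descent[of k] \<open>0 < \<tau>\<close> by (smt (verit) divide_nonneg_nonneg mult_nonneg_nonneg zero_le_power2)
    then have "2 * \<tau> * real k * (f (y (Suc k)) - f z) \<le> 2 * \<tau> * real k * (f (y k) - f z)"
      using \<open>0 < \<tau>\<close> by (intro mult_left_mono) auto
    with Suc gap[of k] show ?case by (simp add: algebra_simps)
  qed simp
  then show ?thesis by (smt (verit) zero_le_power2)
qed

section \<open>Tilted, quadratically regularized convex functions\<close>

text \<open>The subproblems of both methods have this form up to constants in \<open>u\<close>, so the two methods are
  compared through \<open>q\<close> alone.\<close>

definition tilted :: "('a::euclidean_space \<Rightarrow> real) \<Rightarrow> real \<Rightarrow> 'a \<Rightarrow> 'a \<Rightarrow> real" where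
  "tilted J \<mu> q u = J u + 1 / (2 * \<mu>) * (norm u)\<^sup>2 - q \<bullet> u"

text \<open>Strong convexity at a minimizer: minimality is compared with the point at parameter \<open>t\<close> on the
  segment from \<open>w\<close> to \<open>u\<close>, where convexity of \<open>J\<close> and the exact expansion of the quadratic part
  leave the factor \<open>1 - t\<close>; then \<open>t\<close> tends to \<open>0\<close>.\<close>

lemma tilted_quadratic_growth:
  fixes J :: "'a::euclidean_space \<Rightarrow> real"
  assumes J: "convex_on UNIV J" and min: "is_minimizer (tilted J \<mu> q) w"
  shows "tilted J \<mu> q w + 1 / (2 * \<mu>) * (norm (u - w))\<^sup>2 \<le> tilted J \<mu> q u"
proof -
  define c where "c = 1 / (2 * \<mu>)"
  define r where "r = c * (norm (u - w))\<^sup>2"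
  have bound: "(1 - t) * r \<le> tilted J \<mu> q u - tilted J \<mu> q w" if t: "0 < t" "t < 1" for t
  proof -
    let ?m = "(1 - t) *\<^sub>R w + t *\<^sub>R u"
    have conv: "J ?m \<le> (1 - t) * J w + t * J u"
      using convex_onD[OF J, of t w u] t by simp
    have quad: "(norm ?m)\<^sup>2 = (1 - t) * (norm w)\<^sup>2 + t * (norm u)\<^sup>2 - t * (1 - t) * (norm (u - w))\<^sup>2"
      unfolding power2_norm_eq_inner
      by (simp add: inner_add_left inner_add_right inner_diff_left inner_diff_right
          inner_commute algebra_simps)
    have "tilted J \<mu> q w \<le> tilted J \<mu> q ?m"
      using min by (simp add: is_arg_min_linorder)
    also have "\<dots> \<le> (1 - t) * tilted J \<mu> q w + t * tilted J \<mu> q u - t * (1 - t) * r"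
      using conv unfolding tilted_def quad r_def c_def[symmetric]
      by (simp add: inner_add_right algebra_simps)
    finally have "t * ((1 - t) * r) \<le> t * (tilted J \<mu> q u - tilted J \<mu> q w)"
      by (simp add: algebra_simps)
    then show ?thesis using t by simp
  qed
  have "((\<lambda>t. (1 - t) * r) \<longlongrightarrow> (1 - 0) * r) (at_right (0::real))"
    by (intro tendsto_intros)
  moreover have "\<forall>\<^sub>F t in at_right (0::real). (1 - t) * r \<le> tilted J \<mu> q u - tilted J \<mu> q w"
    using bound by (auto simp: eventually_at_right[of 0 "1::real"] intro!: exI[of _ 1])
  ultimately have "(1 - 0) * r \<le> tilted J \<mu> q u - tilted J \<mu> q w"
    by (intro tendsto_upperbound) auto
  then show ?thesis by (simp add: r_def c_def)
qed

lemma tilted_minimizer_unique: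
  fixes J :: "'a::euclidean_space \<Rightarrow> real"
  assumes "convex_on UNIV J" and "\<mu> > 0"
    and "is_minimizer (tilted J \<mu> q) w" and "is_minimizer (tilted J \<mu> q) w'"
  shows "w = w'"
proof -
  have "tilted J \<mu> q w' \<le> tilted J \<mu> q w"
    using assms(4) by (simp add: is_arg_min_linorder)
  with tilted_quadratic_growth[OF assms(1,3), of w'] have "1 / (2 * \<mu>) * (norm (w' - w))\<^sup>2 \<le> 0"
    by linarith
  then have "(norm (w' - w))\<^sup>2 \<le> 0" using \<open>\<mu> > 0\<close> by (simp add: divide_le_0_iff)
  then show ?thesis by simp
qed

text \<open>Changing the tilt adds a linear term, which the quadratic growth around the known minimizer
  dominates outside a ball; on the ball continuity gives a minimizer.\<close>

lemma tilted_minimizer_exists: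
  fixes J :: "'a::euclidean_space \<Rightarrow> real"
  assumes cont: "continuous_on UNIV J" and J: "convex_on UNIV J" and "\<mu> > 0"
    and min: "is_minimizer (tilted J \<mu> q\<^sub>0) w\<^sub>0"
  shows "\<exists>w. is_minimizer (tilted J \<mu> q) w"
proof -
  define R where "R = 2 * \<mu> * norm (q - q\<^sub>0)"
  have "R \<ge> 0" using \<open>\<mu> > 0\<close> by (simp add: R_def)
  have "continuous_on (cball w\<^sub>0 R) (tilted J \<mu> q)"
    unfolding tilted_def
    by (intro continuous_intros continuous_on_subset[OF cont]) auto
  then obtain w where w: "w \<in> cball w\<^sub>0 R" "\<And>u. u \<in> cball w\<^sub>0 R \<Longrightarrow> tilted J \<mu> q w \<le> tilted J \<mu> q u"
    using continuous_attains_inf[of "cball w\<^sub>0 R" "tilted J \<mu> q"] \<open>R \<ge> 0\<close> by auto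
  have out: "tilted J \<mu> q w\<^sub>0 \<le> tilted J \<mu> q u" if "u \<notin> cball w\<^sub>0 R" for u
  proof -
    have "R \<le> norm (u - w\<^sub>0)" using that by (simp add: dist_norm norm_minus_commute)
    then have "norm (q - q\<^sub>0) \<le> 1 / (2 * \<mu>) * norm (u - w\<^sub>0)"
      using \<open>\<mu> > 0\<close> by (simp add: R_def field_simps)
    then have "norm (q - q\<^sub>0) * norm (u - w\<^sub>0) \<le> 1 / (2 * \<mu>) * norm (u - w\<^sub>0) * norm (u - w\<^sub>0)"
      by (rule mult_right_mono) simp
    with norm_cauchy_schwarz[of "q - q\<^sub>0" "u - w\<^sub>0"]
    have "(q - q\<^sub>0) \<bullet> (u - w\<^sub>0) \<le> 1 / (2 * \<mu>) * (norm (u - w\<^sub>0))\<^sup>2"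
      by (simp add: power2_eq_square)
    with tilted_quadratic_growth[OF J min, of u]
    show ?thesis by (simp add: tilted_def inner_diff_left inner_diff_right)
  qed
  have "tilted J \<mu> q w \<le> tilted J \<mu> q u" for u
    using w(2)[of u] w(2)[of w\<^sub>0] out[of u] \<open>R \<ge> 0\<close> by force
  then show ?thesis by (auto simp: is_arg_min_linorder)
qed

section \<open>The Lagrangian and the gradient of the dual objective\<close>

lemma lagrangian_eq_tilted:
  "lagrangian J A b \<mu> w y = tilted J \<mu> (transpose A *v y) w + y \<bullet> b"
  by (simp add: lagrangian_def tilted_def transpose_matrix_vector dot_lmul_matrix inner_diff_right)

lemma lagrangian_minimizer_iff_tilted:
  "is_minimizer (\<lambda>w. lagrangian J A b \<mu> w y) w \<longleftrightarrow> is_minimizer (tilted J \<mu> (transpose A *v y)) w"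
  by (simp add: is_arg_min_linorder lagrangian_eq_tilted)

lemma lagrangian_shift_dual:
  "lagrangian J A b \<mu> w y' = lagrangian J A b \<mu> w y - (y' - y) \<bullet> (A *v w - b)"
  by (simp add: lagrangian_def inner_diff_left)

lemma dual_obj_subgradient:
  assumes "is_minimizer (\<lambda>u. lagrangian J A b \<mu> u y) w"
    and "is_minimizer (\<lambda>u. lagrangian J A b \<mu> u y') w'"
  shows "dual_obj J A b \<mu> y + (y' - y) \<bullet> (A *v w - b) \<le> dual_obj J A b \<mu> y'"
proof -
  have "lagrangian J A b \<mu> w' y' \<le> lagrangian J A b \<mu> w y'"
    using assms(2) by (simp add: is_arg_min_linorder)
  then show ?thesis
    by (simp add: dual_obj_eq[OF assms(1)] dual_obj_eq[OF assms(2)] lagrangian_shift_dual[of _ _ _ _ w y' y])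
qed

text \<open>Moving from \<open>w\<close> to \<open>w'\<close> costs \<open>\<parallel>w' - w\<parallel>\<^sup>2 / (2 \<mu>)\<close> in the Lagrangian at \<open>y\<close> and gains at most
  \<open>A\<^sup>T (y' - y) \<bullet> (w' - w)\<close> from the change of \<open>y\<close>; Young's inequality balances the two.\<close>

lemma dual_obj_quadratic_upper_bound:
  fixes A :: "real ^ 'n ^ 'm"
  assumes J: "convex_on UNIV J" and "\<mu> > 0"
    and w: "is_minimizer (\<lambda>u. lagrangian J A b \<mu> u y) w"
    and w': "is_minimizer (\<lambda>u. lagrangian J A b \<mu> u y') w'"
  shows "dual_obj J A b \<mu> y' \<le> dual_obj J A b \<mu> y + (y' - y) \<bullet> (A *v w - b)
           + \<mu> / 2 * (norm (transpose A *v (y' - y)))\<^sup>2"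
proof -
  let ?a = "transpose A *v (y' - y)" and ?v = "w' - w"
  have growth: "lagrangian J A b \<mu> w y + 1 / (2 * \<mu>) * (norm ?v)\<^sup>2 \<le> lagrangian J A b \<mu> w' y"
    using tilted_quadratic_growth[OF J w[unfolded lagrangian_minimizer_iff_tilted], of w']
    by (simp add: lagrangian_eq_tilted)
  have "0 \<le> 1 / (2 * \<mu>) * (norm (?v - \<mu> *\<^sub>R ?a))\<^sup>2"
    using \<open>\<mu> > 0\<close> by simp
  also have "\<dots> = 1 / (2 * \<mu>) * (norm ?v)\<^sup>2 - ?a \<bullet> ?v + \<mu> / 2 * (norm ?a)\<^sup>2"
    using \<open>\<mu> > 0\<close> unfolding power2_norm_eq_inner inner_diff_left[of ?v] inner_diff_right[of _ ?v]
    by (simp add: inner_commute[of ?v ?a] field_simps del: transpose_matrix_vector)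
  finally have young: "?a \<bullet> ?v \<le> 1 / (2 * \<mu>) * (norm ?v)\<^sup>2 + \<mu> / 2 * (norm ?a)\<^sup>2"
    by linarith
  have "?a \<bullet> ?v = (y' - y) \<bullet> (A *v w' - b) - (y' - y) \<bullet> (A *v w - b)"
    unfolding transpose_matrix_vector dot_lmul_matrix
    by (simp add: matrix_vector_mult_diff_distrib inner_diff_right)
  with growth young show ?thesis
    by (simp add: dual_obj_eq[OF w] dual_obj_eq[OF w'] lagrangian_shift_dual[of _ _ _ _ w' y' y])
qed

lemma gderiv_if_quadratic_remainder:
  fixes f :: "'a::euclidean_space \<Rightarrow> real"
  assumes "\<And>h. \<bar>f (z + h) - f z - h \<bullet> g\<bar> \<le> C * (norm h)\<^sup>2"
  shows "GDERIV f z :> g"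
  unfolding gderiv_def has_derivative_at
proof
  show "bounded_linear (\<lambda>h. h \<bullet> g)" by (rule bounded_linear_inner_left)
  have "((\<lambda>h::'a. C * norm h) \<longlongrightarrow> C * norm (0::'a)) (at 0)"
    by (intro tendsto_intros)
  then have lim: "((\<lambda>h::'a. C * norm h) \<longlongrightarrow> 0) (at 0)" by simp
  show "(\<lambda>h. norm (f (z + h) - f z - h \<bullet> g) / norm h) \<midarrow>0\<rightarrow> 0"
  proof (rule Lim_null_comparison[OF _ lim], rule always_eventually, rule allI)
    fix h :: 'a
    show "norm (norm (f (z + h) - f z - h \<bullet> g) / norm h) \<le> C * norm h"
      using assms[of h] by (cases "h = 0") (auto simp: field_simps power2_eq_square)
  qed
qed

lemma gderiv_dual_obj:
  fixes A :: "real ^ 'n ^ 'm"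
  assumes J: "convex_on UNIV J" and "\<mu> > 0"
    and W: "\<And>y. is_minimizer (\<lambda>u. lagrangian J A b \<mu> u y) (W y)"
  shows "GDERIV (dual_obj J A b \<mu>) y :> A *v W y - b"
proof -
  let ?G = "dual_obj J A b \<mu>"
  obtain K where K: "\<And>h. norm (transpose A *v h) \<le> norm h * K"
    using bounded_linear.bounded[OF matrix_vector_mul_bounded_linear[of "transpose A"]] by blast
  have "\<bar>?G (y + h) - ?G y - h \<bullet> (A *v W y - b)\<bar> \<le> \<mu> / 2 * K\<^sup>2 * (norm h)\<^sup>2" for h
  proof -
    have "\<mu> / 2 * (norm (transpose A *v h))\<^sup>2 \<le> \<mu> / 2 * (norm h * K)\<^sup>2"
      using \<open>\<mu> > 0\<close> K[of h] by (intro mult_left_mono power_mono) auto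
    with dual_obj_subgradient[OF W[of y] W[of "y + h"]]
      dual_obj_quadratic_upper_bound[OF J \<open>\<mu> > 0\<close> W[of y] W[of "y + h"]]
    show ?thesis by (simp add: power_mult_distrib mult_ac)
  qed
  then show ?thesis by (rule gderiv_if_quadratic_remainder)
qed

section \<open>Equivalence of the two methods\<close>

text \<open>Expanding \<open>\<parallel>u - x\<^sub>k\<parallel>\<^sup>2\<close> turns the Bregman subproblem, up to a constant, into the tilted problem
  with \<open>q = p\<^sub>k + x\<^sub>k / \<mu> - \<tau> A\<^sup>T (A x\<^sub>k - b)\<close>.\<close>

lemma linearized_bregman_step_tilted:
  fixes A :: "real ^ 'n ^ 'm"
  assumes "\<mu> > 0" and lb: "linearized_bregman J A b \<mu> \<tau> x p"
  shows "is_minimizer (tilted J \<mu> (p (Suc k) + (1 / \<mu>) *\<^sub>R x (Suc k))) (x (Suc k))"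
proof -
  let ?r = "transpose A *v (A *v x k - b)"
  define q where "q = p (Suc k) + (1 / \<mu>) *\<^sub>R x (Suc k)"
  define c where "c = 1 / (2 * \<mu>) * (norm (x k))\<^sup>2 - J (x k) + p k \<bullet> x k"
  have q: "q = p k - \<tau> *\<^sub>R ?r + (1 / \<mu>) *\<^sub>R x k"
    using lb by (simp add: q_def linearized_bregman_def scaleR_diff_right)
  have "bregman J (p k) u (x k) + \<tau> * (?r \<bullet> u) + 1 / (2 * \<mu>) * (norm (u - x k))\<^sup>2
      = tilted J \<mu> q u + c" for u
  proof -
    have "1 / (2 * \<mu>) * (norm (u - x k))\<^sup>2
        = 1 / (2 * \<mu>) * (norm u)\<^sup>2 - 1 / \<mu> * (x k \<bullet> u) + 1 / (2 * \<mu>) * (norm (x k))\<^sup>2"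
      using \<open>\<mu> > 0\<close> unfolding power2_norm_eq_inner
      by (simp add: inner_diff_left inner_diff_right inner_commute field_simps)
    then show ?thesis
      unfolding bregman_def tilted_def q c_def
      by (simp add: inner_diff_left inner_diff_right inner_add_left)
  qed
  moreover have "is_minimizer (\<lambda>u. bregman J (p k) u (x k) + \<tau> * (?r \<bullet> u)
      + 1 / (2 * \<mu>) * (norm (u - x k))\<^sup>2) (x (Suc k))"
    using lb by (simp add: linearized_bregman_def)
  ultimately show ?thesis
    by (simp add: q_def[symmetric] is_arg_min_linorder)
qed

text \<open>The invariant \<open>p\<^sub>k\<^sub>+\<^sub>1 + x\<^sub>k\<^sub>+\<^sub>1 / \<mu> = A\<^sup>T y\<^sub>k\<close> carries the induction: it identifies \<open>x\<^sub>k\<^sub>+\<^sub>1\<close> with \<open>w\<^sub>k\<^sub>+\<^sub>1\<close>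
  by uniqueness of minimizers, after which both of its sides change by
  \<open>- \<tau> A\<^sup>T (A x\<^sub>k\<^sub>+\<^sub>1 - b)\<close>.\<close>

lemma linearized_bregman_minimizes_lagrangian:
  fixes A :: "real ^ 'n ^ 'm"
  assumes J: "convex_on UNIV J" and "\<mu> > 0"
    and lb: "linearized_bregman J A b \<mu> \<tau> x p"
    and lg: "lagrangian_gradient_method J A b \<mu> \<tau> w y"
  shows "is_minimizer (\<lambda>u. lagrangian J A b \<mu> u (y k)) (x (Suc k))"
proof -
  have lb_step: "p (Suc k) + (1 / \<mu>) *\<^sub>R x (Suc k)
      = p k + (1 / \<mu>) *\<^sub>R x k - \<tau> *\<^sub>R (transpose A *v (A *v x k - b))" for k
    using lb by (simp add: linearized_bregman_def scaleR_diff_right)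
  have "p (Suc k) + (1 / \<mu>) *\<^sub>R x (Suc k) = transpose A *v y k" for k
  proof (induction k)
    case 0
    have "x 0 = 0" "p 0 = 0" "y 0 = \<tau> *\<^sub>R b"
      using lb lg by (auto simp: linearized_bregman_def lagrangian_gradient_method_def)
    then show ?case
      by (subst lb_step) (simp add: matrix_vector_mult_scaleR linear_neg[OF matrix_vector_mul_linear]
          del: transpose_matrix_vector)
  next
    case (Suc k)
    have "is_minimizer (tilted J \<mu> (transpose A *v y k)) (x (Suc k))"
      using linearized_bregman_step_tilted[OF \<open>\<mu> > 0\<close> lb, of k] Suc by simp
    moreover have "is_minimizer (tilted J \<mu> (transpose A *v y k)) (w (Suc k))"
      using lg by (simp add: lagrangian_gradient_method_def lagrangian_minimizer_iff_tilted)
    ultimately have "x (Suc k) = w (Suc k)"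
      by (rule tilted_minimizer_unique[OF J \<open>\<mu> > 0\<close>])
    then have "y (Suc k) = y k - \<tau> *\<^sub>R (A *v x (Suc k) - b)"
      using lg by (simp add: lagrangian_gradient_method_def)
    with Suc show ?case
      by (simp add: lb_step[of "Suc k"] matrix_vector_mult_diff_distrib matrix_vector_mult_scaleR)
  qed
  then show ?thesis
    using linearized_bregman_step_tilted[OF \<open>\<mu> > 0\<close> lb, of k]
    by (simp add: lagrangian_minimizer_iff_tilted)
qed

section \<open>Convergence rate\<close>

theorem theorem3p2:
  fixes J :: "real ^ 'n \<Rightarrow> real" and A :: "real ^ 'n ^ 'm" and b :: "real ^ 'm"
    and \<mu> \<tau> L :: real
    and xs :: "real ^ 'n" and ys :: "real ^ 'm"
    and x p w :: "nat \<Rightarrow> real ^ 'n" and y :: "nat \<Rightarrow> real ^ 'm"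
  assumes "continuous_on UNIV J" and "convex_on UNIV J"
    and "\<mu> > 0"
    and "optimal_pair J A b \<mu> xs ys"
    and "L > 0" and "L-lipschitz_on UNIV (gradient (dual_obj J A b \<mu>))"
    and "0 < \<tau>" and "\<tau> \<le> 1 / L"
    and "linearized_bregman J A b \<mu> \<tau> x p"
    and "lagrangian_gradient_method J A b \<mu> \<tau> w y"
  shows "(\<forall>k\<ge>1. lagrangian J A b \<mu> xs ys - lagrangian J A b \<mu> (x (Suc k)) (y k)
                  \<le> (norm (ys - y 0))\<^sup>2 / (2 * \<tau> * real k)) \<and>
         (\<forall>\<beta>. 0 < \<beta> \<and> \<beta> \<le> 1 \<and> \<beta> / L \<le> \<tau> \<longrightarrow>
            (\<forall>\<epsilon>>0. \<forall>k. \<lceil>(L * (norm (ys - y 0))\<^sup>2 / (2 * \<beta>)) / \<epsilon>\<rceil> \<le> int k \<longrightarrow>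
               lagrangian_eps_optimal J A b \<mu> xs ys \<epsilon> (x (Suc k)) (y k)))"
proof -
  note J = \<open>convex_on UNIV J\<close> and lb = \<open>linearized_bregman J A b \<mu> \<tau> x p\<close>
    and lg = \<open>lagrangian_gradient_method J A b \<mu> \<tau> w y\<close>
  let ?G = "dual_obj J A b \<mu>"
  have xmin: "is_minimizer (\<lambda>u. lagrangian J A b \<mu> u (y k)) (x (Suc k))" for k
    by (rule linearized_bregman_minimizes_lagrangian[OF J \<open>\<mu> > 0\<close> lb lg])
  have wmin: "is_minimizer (\<lambda>u. lagrangian J A b \<mu> u (y k)) (w (Suc k))" for k
    using lg by (simp add: lagrangian_gradient_method_def)
  have "\<exists>v. is_minimizer (\<lambda>u. lagrangian J A b \<mu> u z) v" for z
    using tilted_minimizer_exists[OF \<open>continuous_on UNIV J\<close> J \<open>\<mu> > 0\<close>] wmin[of 0]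
    by (simp add: lagrangian_minimizer_iff_tilted)
  then obtain W where W: "\<And>z. is_minimizer (\<lambda>u. lagrangian J A b \<mu> u z) (W z)"
    by metis
  define g where "g z = A *v W z - b" for z
  have grad: "GDERIV ?G z :> g z" for z
    unfolding g_def by (rule gderiv_dual_obj[OF J \<open>\<mu> > 0\<close> W])
  then have "gradient ?G = g" by (intro ext gradient_eqI)
  with \<open>L-lipschitz_on UNIV (gradient ?G)\<close> have lip: "L-lipschitz_on UNIV g" by simp
  have "W (y k) = w (Suc k)" for k
    using tilted_minimizer_unique[OF J \<open>\<mu> > 0\<close>] W[of "y k"] wmin[of k]
    by (simp add: lagrangian_minimizer_iff_tilted)
  then have step: "y (Suc k) = y k - \<tau> *\<^sub>R g (y k)" for k
    using lg by (simp add: lagrangian_gradient_method_def g_def)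
  have "L * \<tau> \<le> 1"
    using \<open>\<tau> \<le> 1 / L\<close> \<open>L > 0\<close> by (simp add: field_simps)
  then have rate: "2 * \<tau> * real k * (?G (y k) - ?G ys) \<le> (norm (ys - y 0))\<^sup>2" for k
    using gradient_descent_rate[of ?G g L \<tau> y, OF grad lip _ \<open>0 < \<tau>\<close> _ step]
      dual_obj_subgradient[OF W W] by (simp add: g_def)
  have gap: "lagrangian J A b \<mu> xs ys - lagrangian J A b \<mu> (x (Suc k)) (y k) = ?G (y k) - ?G ys" for k
    using \<open>optimal_pair J A b \<mu> xs ys\<close> dual_obj_eq[OF xmin[of k]]
    by (simp add: optimal_pair_def)
  have bound: "?G (y k) - ?G ys \<le> (norm (ys - y 0))\<^sup>2 / (2 * \<tau> * real k)" if "k \<ge> 1" for k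
    using rate[of k] that \<open>0 < \<tau>\<close> by (simp add: field_simps)
  moreover have "?G (y k) - ?G ys \<le> \<epsilon>"
    if \<beta>: "0 < \<beta>" "\<beta> / L \<le> \<tau>" and "\<epsilon> > 0"
      and k: "\<lceil>(L * (norm (ys - y 0))\<^sup>2 / (2 * \<beta>)) / \<epsilon>\<rceil> \<le> int k" for \<beta> \<epsilon> k
  proof (cases "k = 0")
    case True
    \<comment> \<open>The threshold admits \<open>k = 0\<close> only if the dual iteration starts at \<open>ys\<close>.\<close>
    with k have "L * (norm (ys - y 0))\<^sup>2 / (2 * \<beta>) / \<epsilon> \<le> 0" by (simp add: ceiling_le_iff)
    then have "(norm (ys - y 0))\<^sup>2 \<le> 0"
      using \<open>L > 0\<close> \<beta>(1) \<open>\<epsilon> > 0\<close> by (simp add: divide_le_0_iff mult_le_0_iff)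
    then show ?thesis using True \<open>\<epsilon> > 0\<close> by simp
  next
    case False
    let ?N = "(norm (ys - y 0))\<^sup>2"
    have \<beta>L: "\<beta> \<le> L * \<tau>" using \<beta>(2) \<open>L > 0\<close> by (simp add: field_simps)
    have "L * ?N / (2 * \<beta>) / \<epsilon> \<le> real k" using k by (simp add: ceiling_le_iff)
    then have "L * ?N \<le> real k * \<epsilon> * 2 * \<beta>"
      using \<beta>(1) \<open>\<epsilon> > 0\<close> by (simp add: field_simps)
    also have "\<dots> \<le> real k * \<epsilon> * 2 * (L * \<tau>)"
      using \<beta>L \<open>\<epsilon> > 0\<close> by (intro mult_left_mono) auto
    finally have "L * ?N \<le> L * (\<epsilon> * (2 * \<tau> * real k))" by (simp add: mult_ac)
    then have "?N \<le> \<epsilon> * (2 * \<tau> * real k)" using \<open>L > 0\<close> by simp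
    then have "?N / (2 * \<tau> * real k) \<le> \<epsilon>"
      using False \<open>0 < \<tau>\<close> by (simp add: divide_le_eq)
    with bound[of k] False show ?thesis by simp
  qed
  ultimately show ?thesis
    by (auto simp: lagrangian_eps_optimal_def gap)
qed

end
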